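(* Let $d,n\in\mathbb{N}$ with $n>d$, and consider the gradient flow $F\colon\operatorname{S}(d,n)\times[0,\infty)\to\operatorname{S}(d,n)$ defined by the differential equation \[ F(Z_0,0)=Z_0, \qquad \frac{d}{dt}F(Z_0,t)=-\operatorname{grad}\operatorname{FP}(F(Z_0,t)), \] where $\operatorname{FP}(Z)=\|Z^*Z\|_F^2$ and $\operatorname{grad}$ denotes the Riemannian gradient on $\operatorname{S}(d,n)$. If $Z_0\in\operatorname{S}(d,n)$ is full spark, then $\lim_{t\to\infty}F(Z_0,t)$ is a unit norm tight frame.
   Context: Here $d,n\geq1$. $\operatorname{S}(d,n)$ is the set of matrices in $\mathbb{C}^{d\times n}$ all of whose columns have unit Euclidean norm, regarded as a Riemannian submanifold (a product of $n$ unit spheres) of $\mathbb{C}^{d\times n}\cong\mathbb{R}^{2dn}$ with the real inner product $\operatorname{Re}\operatorname{tr}(X^*Y)$. $\|\cdot\|_F$ is the Frobenius norm. A matrix $Z\in\mathbb{C}^{d\times n}$ is full spark if every $d\times d$ submatrix of $Z$ is invertible. A matrix $Z\in\mathbb{C}^{d\times n}$ is a unit norm tight frame if every column has unit norm and $ZZ^*$ is a multiple of the $d\times d$ identity matrix. *)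

theory Defs
  imports "HOL-Analysis.Analysis"
begin

(* A d x n complex matrix is an element of complex^'n^'d, with d = CARD('d) and n = CARD('n);
   the entry in row i and column j is Z $ i $ j. *)

definition conj_transpose :: "complex^'n^'d \<Rightarrow> complex^'d^'n"
  where "conj_transpose Z = (\<chi> j i. cnj (Z $ i $ j))"

(* The library's inner product and norm on complex^'n^'d are Re tr(X* Y) and the Frobenius norm. *)

lemma inner_matrix_eq_Re_trace:
  fixes X Y :: "complex^'n^'d"
  shows "inner X Y = Re (trace (conj_transpose X ** Y))"
proof -
  have "inner X Y = (\<Sum>i\<in>UNIV. \<Sum>j\<in>UNIV. Re (cnj (X $ i $ j) * Y $ i $ j))"
    by (simp add: inner_vec_def inner_complex_def)
  also have "\<dots> = (\<Sum>j\<in>UNIV. \<Sum>i\<in>UNIV. Re (cnj (X $ i $ j) * Y $ i $ j))"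
    by (rule sum.swap)
  also have "\<dots> = Re (trace (conj_transpose X ** Y))"
    by (simp add: trace_def matrix_matrix_mult_def conj_transpose_def)
  finally show ?thesis .
qed

lemma norm_matrix_eq_Frobenius:
  fixes X :: "complex^'n^'d"
  shows "norm X = sqrt (\<Sum>i\<in>UNIV. \<Sum>j\<in>UNIV. (cmod (X $ i $ j))\<^sup>2)"
  by (simp add: norm_vec_def L2_set_def sum_nonneg)

definition unit_norm_matrices :: "(complex^'n^'d) set"
  where "unit_norm_matrices = {Z. \<forall>j. norm (column j Z) = 1}"

definition frame_potential :: "complex^'n^'d \<Rightarrow> real"
  where "frame_potential Z = (norm (conj_transpose Z ** Z))\<^sup>2"

(* c is a C^1 curve in M, defined near time 0, with c(0) = p and c'(0) = v. *)
definition curve_through ::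
    "'a::euclidean_space set \<Rightarrow> 'a \<Rightarrow> 'a \<Rightarrow> (real \<Rightarrow> 'a) \<Rightarrow> bool"
  where "curve_through M p v c \<longleftrightarrow>
    c 0 = p \<and> (c has_vector_derivative v) (at 0) \<and>
    (\<exists>e>0. c ` {-e<..<e} \<subseteq> M \<and> c C1_differentiable_on {-e<..<e})"

definition tangent_vectors :: "'a::euclidean_space set \<Rightarrow> 'a \<Rightarrow> 'a set"
  where "tangent_vectors M p = {v. \<exists>c. curve_through M p v c}"

(* The Riemannian gradient at p of f on the submanifold M, with the metric induced from the
   ambient space: the tangent vector G at p with (f o c)'(0) = <G, c'(0)> for all curves c in M
   through p. Only the values of f on M matter. *)
definition riemannian_grad ::
    "'a::euclidean_space set \<Rightarrow> ('a \<Rightarrow> real) \<Rightarrow> 'a \<Rightarrow> 'a"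
  where "riemannian_grad M f p =
    (THE G. G \<in> tangent_vectors M p \<and>
       (\<forall>v c. curve_through M p v c \<longrightarrow>
          ((\<lambda>t. f (c t)) has_real_derivative inner G v) (at 0)))"

(* F is the flow M x [0,\<infinity>) -> M of -grad f; its values outside this domain are irrelevant. *)
definition is_gradient_flow ::
    "'a::euclidean_space set \<Rightarrow> ('a \<Rightarrow> real) \<Rightarrow> ('a \<Rightarrow> real \<Rightarrow> 'a) \<Rightarrow> bool"
  where "is_gradient_flow M f F \<longleftrightarrow>
    (\<forall>p\<in>M. F p 0 = p \<and>
       (\<forall>t\<ge>0. F p t \<in> M \<and>
          (F p has_vector_derivative - riemannian_grad M f (F p t)) (at t within {0..})))"

(* s selects d distinct columns; their order does not affect invertibility. *)
definition full_spark :: "complex^'n^'d \<Rightarrow> bool"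
  where "full_spark Z \<longleftrightarrow>
    (\<forall>s :: 'd \<Rightarrow> 'n. inj s \<longrightarrow> invertible ((\<chi> i k. Z $ i $ s k) :: complex^'d^'d))"

definition unit_norm_tight_frame :: "complex^'n^'d \<Rightarrow> bool"
  where "unit_norm_tight_frame Z \<longleftrightarrow>
    (\<forall>j. norm (column j Z) = 1) \<and> (\<exists>a. Z ** conj_transpose Z = mat a)"

end

theory Submission
  imports Defs
begin

text \<open>
Write \<open>S = Z Z\<^sup>*\<close> and let \<open>z\<^sub>j\<close> be the columns of \<open>Z\<close>. The gradient of the frame potential has columns
\<open>4 (S z\<^sub>j - \<langle>z\<^sub>j, S z\<^sub>j\<rangle> z\<^sub>j)\<close> (\<open>riemannian_grad_frame_potential\<close>). With the defect
\<open>H = S - (n / d) I\<close>, a traceless matrix, one has \<open>FP Z - n\<^sup>2 / d = \<parallel>H\<parallel>\<^sup>2\<close>, and \<open>H\<close> may replace \<open>S\<close> in the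
gradient. So \<open>Z\<close> is critical exactly when all \<open>z\<^sub>j\<close> are eigenvectors of \<open>H\<close>. If \<open>Z\<close> is full spark and \<open>n > d\<close>,
this forces \<open>H = 0\<close> (\<open>traceless_eigenvectors_full_spark\<close>): the only full spark critical points are
tight frames. What has to be excluded is that the trajectory loses full spark in the limit.

This is where a monotone quantity helps. The flow acts on \<open>Z\<close> by a matrix on the left and a diagonal
matrix on the right, so each maximal minor satisfies a scalar linear equation. Its growth rate may be
negative, but the rates of all maximal minors add up to a positive multiple of \<open>FP Z - n\<^sup>2 / d \<ge> 0\<close>
(\<open>spark_product_has_real_derivative\<close>). Hence the product of the squared moduli of all maximal minors
never decreases, and the trajectory stays in a superlevel set of this product, a compact set
of full spark matrices.

On that compact set the norm of the gradient is at least a constant times \<open>\<parallel>H\<parallel>\<close>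
(\<open>gradient_inequality\<close>), so \<open>\<parallel>H\<parallel>\<^sup>2\<close> decays exponentially. The speed of the flow is at most a constant
times \<open>\<parallel>H\<parallel>\<close>, so it decays exponentially too, the trajectory has finite length and converges
(\<open>exponential_decay_converges\<close>), and its limit satisfies \<open>H = 0\<close>.
\<close>

section \<open>The tangent space and the gradient\<close>

text \<open>For unit norm columns of \<open>Z\<close>, the orthogonal projection of each column of \<open>X\<close> onto the
tangent space of the unit sphere at the corresponding column of \<open>Z\<close>.\<close>
definition tangent_proj :: "complex^'n^'d \<Rightarrow> complex^'n^'d \<Rightarrow> complex^'n^'d"
  where "tangent_proj Z X =
    (\<chi> i j. X $ i $ j - inner (column j Z) (column j X) *\<^sub>R Z $ i $ j)"

lemma inner_eq_sum_columns:
  fixes X Y :: "complex^'n^'d"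
  shows "inner X Y = (\<Sum>j\<in>UNIV. inner (column j X) (column j Y))"
  by (simp add: inner_vec_def column_def) (rule sum.swap)

lemma bounded_linear_column: "bounded_linear (\<lambda>X :: complex^'n^'d. column j X)"
  by (intro linear_conv_bounded_linear[THEN iffD1] linearI) (simp_all add: column_def vec_eq_iff)

lemma column_scaleR:
  fixes X :: "complex^'n^'d"
  shows "column j (r *\<^sub>R X) = r *\<^sub>R column j X"
  by (simp add: column_def vec_eq_iff)

lemma column_diff:
  fixes X Y :: "complex^'n^'d"
  shows "column j (X - Y) = column j X - column j Y"
  by (simp add: column_def vec_eq_iff)

lemma bounded_bilinear_matrix_mult:
  "bounded_bilinear ((**) :: complex^'m^'k \<Rightarrow> complex^'l^'m \<Rightarrow> complex^'l^'k)"
  unfolding bilinear_conv_bounded_bilinear[symmetric] bilinear_def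
  by (auto intro!: linearI simp: matrix_matrix_mult_def vec_eq_iff
      distrib_left distrib_right sum.distrib scaleR_sum_right)

lemma bounded_linear_conj_transpose:
  "bounded_linear (conj_transpose :: complex^'n^'d \<Rightarrow> complex^'d^'n)"
  by (intro linear_conv_bounded_linear[THEN iffD1] linearI)
    (simp_all add: conj_transpose_def vec_eq_iff)

lemma inner_conj_transpose:
  fixes A B :: "complex^'n^'d"
  shows "inner (conj_transpose A) (conj_transpose B) = inner A B"
  by (simp add: inner_vec_def conj_transpose_def inner_complex_def) (rule sum.swap)

lemma conj_transpose_conj_transpose [simp]: "conj_transpose (conj_transpose Z) = Z"
  by (simp add: conj_transpose_def vec_eq_iff)

lemma conj_transpose_matrix_mult:
  "conj_transpose (A ** B) = conj_transpose B ** conj_transpose A"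
  by (simp add: conj_transpose_def vec_eq_iff matrix_matrix_mult_def mult.commute)

lemma inner_matrix_mult_left:
  fixes A :: "complex^'m^'k" and B :: "complex^'l^'m" and C :: "complex^'l^'k"
  shows "inner (A ** B) C = inner B (conj_transpose A ** C)"
  by (simp add: inner_matrix_eq_Re_trace conj_transpose_matrix_mult matrix_mul_assoc)

lemma inner_matrix_mult_right:
  fixes A :: "complex^'m^'k" and B :: "complex^'l^'m" and C :: "complex^'l^'k"
  shows "inner (A ** B) C = inner A (C ** conj_transpose B)"
proof -
  have "inner (A ** B) C = inner (conj_transpose B ** conj_transpose A) (conj_transpose C)"
    by (simp flip: conj_transpose_matrix_mult add: inner_conj_transpose)
  also have "\<dots> = inner (conj_transpose A) (conj_transpose (C ** conj_transpose B))"
    by (simp add: inner_matrix_mult_left conj_transpose_matrix_mult)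
  finally show ?thesis by (simp add: inner_conj_transpose)
qed

lemma column_tangent_proj:
  "column j (tangent_proj Z X) = column j X - inner (column j Z) (column j X) *\<^sub>R column j Z"
  by (simp add: tangent_proj_def column_def vec_eq_iff)

lemma unit_columnD: "Z \<in> unit_norm_matrices \<Longrightarrow> inner (column j Z) (column j Z) = 1"
  by (simp add: unit_norm_matrices_def dot_square_norm)

lemma tangent_proj_tangent:
  assumes "Z \<in> unit_norm_matrices"
  shows "inner (column j Z) (column j (tangent_proj Z X)) = 0"
  using unit_columnD[OF assms, of j] by (simp add: column_tangent_proj inner_diff_right)

lemma inner_tangent_proj:
  assumes "\<And>j. inner (column j Z) (column j V) = 0"
  shows "inner (tangent_proj Z X) V = inner X V"
  by (simp add: inner_eq_sum_columns column_tangent_proj inner_diff_left assms)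

lemma norm_tangent_proj_le:
  assumes "Z \<in> unit_norm_matrices"
  shows "norm (tangent_proj Z X) \<le> norm X"
proof -
  have "(norm (tangent_proj Z X))\<^sup>2 = inner X (tangent_proj Z X)"
    using inner_tangent_proj[OF tangent_proj_tangent[OF assms]] by (simp add: power2_norm_eq_inner)
  also have "\<dots> \<le> norm X * norm (tangent_proj Z X)" by (rule norm_cauchy_schwarz)
  finally show ?thesis
    by (metis mult_right_le_imp_le norm_ge_zero order_le_less power2_eq_square)
qed

text \<open>A curve in a product of spheres has velocity orthogonal to its position in each column, by
differentiating the squared column norms. Conversely every such direction \<open>V\<close> is the velocity of the
curve that follows, in each column, the great circle \<open>cos (q t) z + sin (q t) v / q\<close> with
\<open>q = norm v\<close>.\<close>
lemma tangent_vectors_unit_norm_matrices: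
  fixes Z :: "complex^'n^'d"
  assumes Z: "Z \<in> unit_norm_matrices"
  shows "tangent_vectors unit_norm_matrices Z = {V. \<forall>j. inner (column j Z) (column j V) = 0}"
proof (intro equalityI subsetI CollectI allI)
  fix V :: "complex^'n^'d" and j
  assume "V \<in> tangent_vectors unit_norm_matrices Z"
  then obtain c where c: "c 0 = Z" "(c has_vector_derivative V) (at 0)"
    and ex: "\<exists>e>0. c ` {-e<..<e} \<subseteq> unit_norm_matrices"
    unfolding tangent_vectors_def curve_through_def by blast
  obtain e where e: "e > 0" "c ` {-e<..<e} \<subseteq> unit_norm_matrices" using ex by blast
  let ?l = "\<lambda>t. inner (column j (c t)) (column j (c t))"
  have d1: "((\<lambda>t. column j (c t)) has_vector_derivative column j V) (at 0)"
    by (rule bounded_linear.has_vector_derivative[OF bounded_linear_column c(2)])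
  have "(?l has_vector_derivative 2 * inner (column j Z) (column j V)) (at 0)"
    using bounded_bilinear.has_vector_derivative[OF bounded_bilinear_inner d1 d1] c(1)
    by (simp add: inner_commute)
  moreover have "(?l has_vector_derivative 0) (at 0)"
  proof (rule has_vector_derivative_transform_within_open[where f="\<lambda>_. 1" and S="{-e<..<e}"])
    fix t assume "t \<in> {-e<..<e}"
    then have "c t \<in> unit_norm_matrices" using e by blast
    then show "1 = ?l t" by (simp add: unit_columnD)
  qed (use e in \<open>auto intro: has_vector_derivative_const\<close>)
  ultimately show "inner (column j Z) (column j V) = 0"
    using vector_derivative_unique_at by fastforce
next
  fix V :: "complex^'n^'d"
  assume "V \<in> {V. \<forall>j. inner (column j Z) (column j V) = 0}"
  then have V: "inner (column j Z) (column j V) = 0" for j by blast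
  define q where "q j = norm (column j V)" for j
  define M :: "'n \<Rightarrow> complex^'n^'d \<Rightarrow> complex^'n^'d" where "M j X = (\<chi> i k. if k = j then X $ i $ k else 0)" for j X
  \<comment> \<open>A column with \<open>q j = 0\<close> has to stand still; it does, since then \<open>sin (q j * t) / q j = 0\<close>.\<close>
  define c where "c t = (\<Sum>j\<in>UNIV. cos (q j * t) *\<^sub>R M j Z + (sin (q j * t) / q j) *\<^sub>R M j V)" for t
  define c' where "c' t = (\<Sum>j\<in>UNIV. (- q j * sin (q j * t)) *\<^sub>R M j Z + cos (q j * t) *\<^sub>R M j V)" for t
  have sumM: "(\<Sum>j\<in>UNIV. M j X) = X" for X
    by (simp add: M_def vec_eq_iff)
  have q0: "q j = 0 \<Longrightarrow> M j V = 0" for j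
    by (auto simp: q_def M_def column_def vec_eq_iff)
  have der: "(c has_vector_derivative c' t) (at t)" for t
    unfolding c_def c'_def
  proof (rule has_vector_derivative_sum)
    fix j
    have "((\<lambda>t. sin (q j * t) / q j) has_real_derivative cos (q j * t)) (at t)" if "q j \<noteq> 0"
      using that by (auto intro!: derivative_eq_intros)
    then have 1: "((\<lambda>t. (sin (q j * t) / q j) *\<^sub>R M j V) has_vector_derivative cos (q j * t) *\<^sub>R M j V) (at t)"
      using q0[of j] by (cases "q j = 0") (auto intro!: derivative_eq_intros)
    have "((\<lambda>t. cos (q j * t)) has_real_derivative - q j * sin (q j * t)) (at t)"
      by (auto intro!: derivative_eq_intros)
    then have 2: "((\<lambda>t. cos (q j * t) *\<^sub>R M j Z) has_vector_derivative (- q j * sin (q j * t)) *\<^sub>R M j Z) (at t)"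
      by (auto intro!: derivative_eq_intros)
    show "((\<lambda>t. cos (q j * t) *\<^sub>R M j Z + (sin (q j * t) / q j) *\<^sub>R M j V) has_vector_derivative
      (- q j * sin (q j * t)) *\<^sub>R M j Z + cos (q j * t) *\<^sub>R M j V) (at t)"
      by (rule has_vector_derivative_add[OF 2 1])
  qed
  have col: "column k (c t) = cos (q k * t) *\<^sub>R column k Z + (sin (q k * t) / q k) *\<^sub>R column k V" for k t
    unfolding c_def M_def column_def by (simp add: vec_eq_iff if_distrib if_distribR cong: if_cong)
  have "c t \<in> unit_norm_matrices" for t
    unfolding unit_norm_matrices_def
  proof (intro CollectI allI)
    fix k
    have vv: "inner (column k V) (column k V) = (q k)\<^sup>2" by (simp add: q_def power2_norm_eq_inner)
    have "(norm (column k (c t)))\<^sup>2 = (cos (q k * t))\<^sup>2 + (sin (q k * t) / q k)\<^sup>2 * (q k)\<^sup>2"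
      unfolding power2_norm_eq_inner col using V[of k] unit_columnD[OF Z, of k]
      by (simp add: inner_add_left inner_add_right inner_commute vv power2_eq_square)
    also have "\<dots> = 1" by (cases "q k = 0") (auto simp: power_divide)
    finally show "norm (column k (c t)) = 1"
      by (metis norm_ge_zero one_power2 power2_eq_iff_nonneg zero_le_one)
  qed
  moreover have "continuous_on {-1<..<1} c'"
    unfolding c'_def by (intro continuous_intros)
  then have "c C1_differentiable_on {-1<..<1}"
    unfolding C1_differentiable_on_def using der by blast
  moreover have "c 0 = Z" "c' 0 = V" by (simp_all add: c_def c'_def sumM)
  ultimately have "curve_through unit_norm_matrices Z V c"
    unfolding curve_through_def using der[of 0] by (auto intro!: exI[of _ 1])
  then show "V \<in> tangent_vectors unit_norm_matrices Z"
    by (auto simp: tangent_vectors_def)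
qed

text \<open>With \<open>FP Z = \<parallel>Z\<^sup>* Z\<parallel>\<^sup>2\<close> the product rule gives \<open>2 \<langle>Z\<^sup>* Z, Z\<^sup>* V + V\<^sup>* Z\<rangle>\<close>; the two terms agree because
conjugate transposition is an isometry, and moving \<open>Z\<^sup>*\<close> across the inner product leaves the ambient
gradient \<open>4 Z Z\<^sup>* Z\<close>.\<close>
lemma frame_potential_has_vector_derivative:
  fixes c :: "real \<Rightarrow> complex^'n^'d"
  assumes "(c has_vector_derivative V) (at t within S)"
  shows "((\<lambda>t. frame_potential (c t)) has_vector_derivative
    4 * inner (c t ** conj_transpose (c t) ** c t) V) (at t within S)"
proof -
  let ?G = "\<lambda>t. conj_transpose (c t) ** c t"
  let ?V = "conj_transpose (c t) ** V + conj_transpose V ** c t"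
  have 1: "(?G has_vector_derivative ?V) (at t within S)"
    by (rule bounded_bilinear.has_vector_derivative[OF bounded_bilinear_matrix_mult
          bounded_linear.has_vector_derivative[OF bounded_linear_conj_transpose assms] assms])
  have "((\<lambda>t. inner (?G t) (?G t)) has_vector_derivative inner (?G t) ?V + inner ?V (?G t)) (at t within S)"
    by (rule bounded_bilinear.has_vector_derivative[OF bounded_bilinear_inner 1 1])
  moreover have "inner (?G t) (conj_transpose V ** c t) = inner (?G t) (conj_transpose (c t) ** V)"
    by (subst inner_conj_transpose[symmetric]) (simp add: conj_transpose_matrix_mult)
  moreover have "inner (?G t) (conj_transpose (c t) ** V) = inner (c t ** conj_transpose (c t) ** c t) V"
    by (subst inner_commute, subst inner_matrix_mult_left) (simp add: inner_commute matrix_mul_assoc)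
  ultimately show ?thesis
    unfolding frame_potential_def power2_norm_eq_inner by (simp add: inner_add_left inner_add_right inner_commute)
qed

text \<open>The Riemannian gradient is the tangential part of the ambient gradient. It is the only candidate,
since the tangent space is closed under differences: the difference of two candidates is itself a
velocity, hence orthogonal to itself.\<close>
lemma riemannian_grad_frame_potential:
  fixes Z :: "complex^'n^'d"
  assumes Z: "Z \<in> unit_norm_matrices"
  shows "riemannian_grad unit_norm_matrices frame_potential Z
    = 4 *\<^sub>R tangent_proj Z (Z ** conj_transpose Z ** Z)" (is "_ = ?G")
  unfolding riemannian_grad_def
proof (rule the_equality)
  have tan: "tangent_vectors unit_norm_matrices Z = {V. \<forall>j. inner (column j Z) (column j V) = 0}"
    by (rule tangent_vectors_unit_norm_matrices[OF Z])
  have der: "((\<lambda>t. frame_potential (c t)) has_real_derivative inner ?G v) (at 0)"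
    if "curve_through unit_norm_matrices Z v c" for v c
  proof -
    have c: "c 0 = Z" "(c has_vector_derivative v) (at 0)"
      using that by (auto simp: curve_through_def)
    have "v \<in> tangent_vectors unit_norm_matrices Z" using that by (auto simp: tangent_vectors_def)
    then have "inner (tangent_proj Z (Z ** conj_transpose Z ** Z)) v = inner (Z ** conj_transpose Z ** Z) v"
      using tan by (intro inner_tangent_proj) auto
    then show ?thesis
      using frame_potential_has_vector_derivative[OF c(2)] c(1)
      by (simp add: has_real_derivative_iff_has_vector_derivative)
  qed
  show "?G \<in> tangent_vectors unit_norm_matrices Z \<and>
    (\<forall>v c. curve_through unit_norm_matrices Z v c \<longrightarrow>
       ((\<lambda>t. frame_potential (c t)) has_real_derivative inner ?G v) (at 0))"
    using der by (auto simp: tan column_scaleR tangent_proj_tangent[OF Z])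
  fix G assume G: "G \<in> tangent_vectors unit_norm_matrices Z \<and>
    (\<forall>v c. curve_through unit_norm_matrices Z v c \<longrightarrow>
       ((\<lambda>t. frame_potential (c t)) has_real_derivative inner G v) (at 0))"
  have "G - ?G \<in> tangent_vectors unit_norm_matrices Z"
    using G by (auto simp: tan column_scaleR column_diff inner_diff_right tangent_proj_tangent[OF Z])
  then obtain c where c: "curve_through unit_norm_matrices Z (G - ?G) c"
    by (auto simp: tangent_vectors_def)
  have "inner G (G - ?G) = inner ?G (G - ?G)"
    using G der[OF c] c DERIV_unique by blast
  then have "inner (G - ?G) (G - ?G) = 0" by (simp add: inner_diff_left)
  then show "G = ?G" by simp
qed

section \<open>Derivatives of maximal minors\<close>

text \<open>The derivative of \<open>det\<close> at \<open>A\<close> in direction \<open>B\<close>, from the Leibniz expansion.\<close>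
definition det_deriv :: "complex^'d^'d \<Rightarrow> complex^'d^'d \<Rightarrow> complex"
  where "det_deriv A B = (\<Sum>p | p permutes (UNIV :: 'd set). of_int (sign p) *
    (\<Sum>i\<in>UNIV. B $ i $ p i * (\<Prod>j\<in>UNIV - {i}. A $ j $ p j)))"

lemma has_derivative_det:
  fixes A :: "complex^'d^'d"
  shows "(det has_derivative det_deriv A) (at A within S)"
proof -
  have 1: "((\<lambda>A :: complex^'d^'d. A $ i $ j) has_derivative (\<lambda>B. B $ i $ j)) (at A within S)" for i j :: 'd and A S
    by (intro bounded_linear.has_derivative[OF bounded_linear_vec_nth] has_derivative_ident)
  show ?thesis
    unfolding det_def[abs_def] det_deriv_def[abs_def]
    by (intro has_derivative_sum has_derivative_mult_right has_derivative_prod 1)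
qed

text \<open>In the Leibniz expansion at the identity only \<open>p = id\<close> contributes to first order: any other
permutation moves at least two points, so a vanishing off-diagonal factor remains.\<close>
lemma det_deriv_mat_1:
  fixes M :: "complex^'d^'d"
  shows "det_deriv (mat 1) M = trace M"
proof -
  have "(\<Sum>i\<in>UNIV. M $ i $ p i * (\<Prod>j\<in>UNIV - {i}. (mat 1 :: complex^'d^'d) $ j $ p j)) = 0"
    if p: "p permutes (UNIV :: 'd set)" "p \<noteq> id" for p
  proof (intro sum.neutral ballI)
    fix i
    obtain k where k: "p k \<noteq> k" using p(2) by (metis eq_id_iff)
    have "p (p k) \<noteq> p k" using k permutes_inj[OF p(1)] by (metis injD)
    then obtain j where j: "j \<noteq> i" "p j \<noteq> j" using k by metis
    have "(\<Prod>j\<in>UNIV - {i}. (mat 1 :: complex^'d^'d) $ j $ p j) = 0"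
      using j by (intro prod_zero bexI[of _ j]) (auto simp: mat_def)
    then show "M $ i $ p i * (\<Prod>j\<in>UNIV - {i}. (mat 1 :: complex^'d^'d) $ j $ p j) = 0" by simp
  qed
  then have "det_deriv (mat 1) M = (\<Sum>p | p permutes (UNIV :: 'd set).
      if p = id then (\<Sum>i\<in>UNIV. M $ i $ i) else 0)"
    unfolding det_deriv_def by (intro sum.cong) (auto simp: mat_def sign_id)
  also have "\<dots> = trace M"
    by (simp add: trace_def permutes_id finite_permutations)
  finally show ?thesis .
qed

lemma linear_det_deriv: "linear (det_deriv A)"
  using has_derivative_linear[OF has_derivative_det[of A UNIV]] by simp

text \<open>A way to obtain Jacobi's formula without adjugates and for singular matrices too: differentiate
the multiplicativity law \<open>det (L X) = c * det X\<close> at the identity. It is applied to left and to right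
multiplication by a fixed matrix.\<close>
lemma det_deriv_eqI:
  assumes "\<And>X. det (L X) = c * det X" "bounded_linear L" "L (mat 1) = A"
  shows "det_deriv A (L M) = c * trace M"
proof -
  have "((\<lambda>X. det (L X)) has_derivative (\<lambda>X. det_deriv A (L X))) (at (mat 1))"
    using has_derivative_compose[OF bounded_linear.has_derivative[OF assms(2) has_derivative_ident]
        has_derivative_det, of "mat 1"] assms(3) by simp
  moreover have "((\<lambda>X. c * det X) has_derivative (\<lambda>X. c * det_deriv (mat 1) X)) (at (mat 1))"
    by (intro has_derivative_mult_right has_derivative_det)
  ultimately have "(\<lambda>X. det_deriv A (L X)) = (\<lambda>X. c * det_deriv (mat 1) X)"
    unfolding assms(1) by (rule has_derivative_unique)
  then show ?thesis by (metis det_deriv_mat_1)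
qed

lemma det_deriv_mult_left: "det_deriv A (M ** A) = trace M * det A"
  using det_deriv_eqI[of "\<lambda>X. X ** A" "det A" A M]
  by (simp add: det_mul bounded_bilinear.bounded_linear_left[OF bounded_bilinear_matrix_mult] mult.commute)

lemma det_deriv_mult_right: "det_deriv A (A ** M) = trace M * det A"
  using det_deriv_eqI[of "\<lambda>X. A ** X" "det A" A M]
  by (simp add: det_mul bounded_bilinear.bounded_linear_right[OF bounded_bilinear_matrix_mult] mult.commute)

definition select_columns :: "('d \<Rightarrow> 'n) \<Rightarrow> complex^'n^'d \<Rightarrow> complex^'d^'d"
  where "select_columns s Z = (\<chi> i k. Z $ i $ s k)"

lemma bounded_linear_select_columns: "bounded_linear (select_columns s)"
  by (intro linear_conv_bounded_linear[THEN iffD1] linearI) (simp_all add: select_columns_def vec_eq_iff)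

lemma select_columns_matrix_mult: "select_columns s (M ** Z) = M ** select_columns s Z"
  by (simp add: select_columns_def matrix_matrix_mult_def vec_eq_iff)

lemma select_columns_tangent_proj:
  fixes Z X :: "complex^'n^'d"
  shows "select_columns s (tangent_proj Z X) = select_columns s X - select_columns s Z **
    (\<chi> k l. if k = l then of_real (inner (column (s k) Z) (column (s k) X)) else 0)"
  by (simp add: select_columns_def tangent_proj_def matrix_matrix_mult_def vec_eq_iff
      if_distrib scaleR_conv_of_real mult.commute cong: if_cong)

text \<open>The velocity is \<open>M Z - Z D\<close> with \<open>D\<close> diagonal. Selecting columns commutes with both
multiplications, for the right one because \<open>D\<close> is diagonal, so each selected square matrix \<open>A\<close> moves
by \<open>M A - A E\<close> and its determinant changes at the relative rate \<open>trace M - trace E\<close>.\<close>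
lemma det_deriv_select_columns_flow:
  fixes Z :: "complex^'n^'d" and M :: "complex^'d^'d"
  shows "det_deriv (select_columns s Z) (select_columns s (tangent_proj Z (M ** Z))) =
    (trace M - of_real (\<Sum>k\<in>UNIV. inner (column (s k) Z) (column (s k) (M ** Z)))) *
      det (select_columns s Z)"
  unfolding select_columns_tangent_proj select_columns_matrix_mult
    linear_diff[OF linear_det_deriv] det_deriv_mult_left det_deriv_mult_right
  by (simp add: trace_def left_diff_distrib)

text \<open>Counting pairs of a selection and a position in two ways; it makes the total growth rate of all
maximal minors depend only on the frame potential, which is the sum of the \<open>a j\<close> there.\<close>
lemma sum_over_injections:
  fixes a :: "'n::finite \<Rightarrow> real"
  shows "real CARD('n) * (\<Sum>s | inj (s :: 'd::finite \<Rightarrow> 'n). \<Sum>k\<in>UNIV. a (s k)) =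
    real (card {s :: 'd \<Rightarrow> 'n. inj s}) * real CARD('d) * (\<Sum>j\<in>UNIV. a j)"
proof -
  let ?I = "{s :: 'd \<Rightarrow> 'n. inj s}"
  \<comment> \<open>Every column is selected equally often, because transpositions of the columns act on the selections.\<close>
  define w where "w j = (\<Sum>s\<in>?I. \<Sum>k\<in>UNIV. of_bool (s k = j) :: real)" for j
  have w_eq: "w i = w j" for i j
    unfolding w_def
  proof (rule sum.reindex_bij_witness[of _ "\<lambda>s. Transposition.transpose i j \<circ> s" "\<lambda>s. Transposition.transpose i j \<circ> s"])
    fix s :: "'d \<Rightarrow> 'n"
    assume s: "s \<in> ?I"
    show "Transposition.transpose i j \<circ> s \<in> ?I"
      using s by (auto intro: inj_compose)
    show "Transposition.transpose i j \<circ> (Transposition.transpose i j \<circ> s) = s"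
      by (simp add: fun_eq_iff)
    show "(\<Sum>k\<in>UNIV. of_bool ((Transposition.transpose i j \<circ> s) k = j)) = (\<Sum>k\<in>UNIV. of_bool (s k = i) :: real)"
      by (intro sum.cong) (auto simp: Transposition.transpose_def)
  qed (auto intro: inj_compose simp: fun_eq_iff)
  have sum_w: "(\<Sum>s\<in>?I. \<Sum>k\<in>UNIV. b (s k)) = (\<Sum>j\<in>UNIV. w j * b j)" for b :: "'n \<Rightarrow> real"
  proof -
    have "(\<Sum>s\<in>?I. \<Sum>k\<in>UNIV. b (s k)) = (\<Sum>s\<in>?I. \<Sum>k\<in>UNIV. \<Sum>j\<in>UNIV. of_bool (s k = j) * b j)"
      by simp
    also have "\<dots> = (\<Sum>s\<in>?I. \<Sum>j\<in>UNIV. \<Sum>k\<in>UNIV. of_bool (s k = j) * b j)"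
      by (intro sum.cong refl sum.swap)
    also have "\<dots> = (\<Sum>j\<in>UNIV. \<Sum>s\<in>?I. \<Sum>k\<in>UNIV. of_bool (s k = j) * b j)"
      by (rule sum.swap)
    finally show ?thesis by (simp only: w_def sum_distrib_right)
  qed
  obtain W where W: "w j = W" for j using w_eq by metis
  have "real (card ?I) * real CARD('d) = W * real CARD('n)"
    using sum_w[of "\<lambda>_. 1"] by (simp add: W)
  then show ?thesis
    unfolding sum_w W by (simp add: sum_distrib_left[symmetric])
qed

section \<open>The frame defect and the gradient inequality\<close>

text \<open>For unit norm columns \<open>Z Z\<^sup>*\<close> has trace \<open>n\<close>, so \<open>n / d\<close> times the identity is the only
multiple of the identity that it can equal; the defect vanishes exactly at the unit norm tight frames.\<close>
definition frame_defect :: "complex^'n^'d \<Rightarrow> complex^'d^'d"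
  where "frame_defect Z = Z ** conj_transpose Z - mat (of_real (real CARD('n) / real CARD('d)))"

lemma trace_frame_operator:
  fixes Z :: "complex^'n^'d"
  assumes "Z \<in> unit_norm_matrices"
  shows "trace (Z ** conj_transpose Z) = of_nat CARD('n)"
proof -
  have "(conj_transpose Z ** Z) $ j $ j = of_real (inner (column j Z) (column j Z))" for j
    by (simp add: matrix_matrix_mult_def conj_transpose_def column_def inner_vec_def
        mult.commute flip: complex_norm_square power2_norm_eq_inner)
  then have "trace (conj_transpose Z ** Z) = of_nat CARD('n)"
    by (simp add: trace_def unit_columnD[OF assms])
  then show ?thesis by (subst trace_mul_sym)
qed

lemma trace_mat: "trace (mat c :: 'a::comm_semiring_1^'d^'d) = of_nat CARD('d) * c"
  by (simp add: trace_def mat_def)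

lemma trace_frame_defect:
  assumes "Z \<in> unit_norm_matrices"
  shows "trace (frame_defect Z) = 0"
  by (simp add: frame_defect_def trace_sub trace_mat trace_frame_operator[OF assms])

lemma frame_potential_eq_inner:
  fixes Z :: "complex^'n^'d"
  shows "frame_potential Z = inner Z (Z ** conj_transpose Z ** Z)"
  unfolding frame_potential_def power2_norm_eq_inner
  by (subst inner_matrix_mult_left) (simp add: matrix_mul_assoc)

text \<open>The frame potential exceeds its lower bound \<open>n\<^sup>2 / d\<close> by the squared norm of the defect, because
\<open>\<parallel>Z\<^sup>* Z\<parallel> = \<parallel>Z Z\<^sup>*\<parallel>\<close> and the defect is the traceless part of \<open>Z Z\<^sup>*\<close>.\<close>
lemma norm_frame_defect:
  fixes Z :: "complex^'n^'d"
  assumes Z: "Z \<in> unit_norm_matrices"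
  shows "(norm (frame_defect Z))\<^sup>2 = frame_potential Z - (real CARD('n))\<^sup>2 / real CARD('d)"
proof -
  define r where "r = real CARD('n) / real CARD('d)"
  let ?S = "Z ** conj_transpose Z" and ?I = "mat (of_real r) :: complex^'d^'d"
  have ct: "conj_transpose ?I = ?I"
    by (simp add: conj_transpose_def mat_def vec_eq_iff)
  have "inner ?S ?S = frame_potential Z"
    unfolding frame_potential_eq_inner by (subst inner_matrix_mult_right) simp
  moreover have I: "inner ?I X = r * Re (trace X)" for X
    unfolding inner_matrix_eq_Re_trace ct
    by (simp add: trace_def matrix_matrix_mult_def mat_def if_distrib if_distribR sum_distrib_left cong: if_cong)
  ultimately have "(norm (frame_defect Z))\<^sup>2 =
    frame_potential Z - 2 * r * real CARD('n) + r * (real CARD('d) * r)"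
    unfolding frame_defect_def r_def[symmetric] power2_norm_eq_inner
    by (simp add: inner_diff_left inner_diff_right inner_commute[of ?S ?I] trace_mat trace_frame_operator[OF Z])
  also have "\<dots> = frame_potential Z - (real CARD('n))\<^sup>2 / real CARD('d)"
    by (simp add: r_def field_simps power2_eq_square)
  finally show ?thesis .
qed

lemma matrix_mult_mat_of_real:
  fixes Z :: "complex^'n^'d"
  shows "mat (of_real r) ** Z = r *\<^sub>R Z"
  by (simp add: matrix_matrix_mult_def mat_def vec_eq_iff if_distrib if_distribR cong: if_cong)
    (simp add: scaleR_conv_of_real)

text \<open>Subtracting a real multiple of \<open>Z\<close> does not change the tangential part, so the gradient can be written
with the defect in place of \<open>Z Z\<^sup>*\<close>; this makes it small when the defect is small.\<close>
lemma tangent_proj_frame_defect: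
  fixes Z :: "complex^'n^'d"
  assumes Z: "Z \<in> unit_norm_matrices"
  shows "tangent_proj Z (frame_defect Z ** Z) = tangent_proj Z (Z ** conj_transpose Z ** Z)"
proof -
  have "tangent_proj Z (X - r *\<^sub>R Z) = tangent_proj Z X" for r and X :: "complex^'n^'d"
    unfolding tangent_proj_def column_diff column_scaleR
    by (simp add: vec_eq_iff inner_diff_right unit_columnD[OF Z] algebra_simps)
  then show ?thesis
    by (simp only: frame_defect_def bounded_bilinear.diff_left[OF bounded_bilinear_matrix_mult]
        matrix_mult_mat_of_real)
qed

lemma full_spark_iff_det:
  "full_spark Z \<longleftrightarrow> (\<forall>s. inj s \<longrightarrow> det (select_columns s Z) \<noteq> 0)"
  by (simp add: full_spark_def select_columns_def invertible_det_nz)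

text \<open>Here \<open>n > d\<close> and full spark enter. Choose \<open>d\<close> columns and one more. The \<open>d\<close> columns form an eigenbasis
of \<open>H\<close>, and in that basis the extra column has no zero coordinate, for by Cramer's rule a coordinate is
a quotient of maximal minors. An eigenvector with all coordinates nonzero forces all the eigenvalues to agree,
so \<open>H\<close> is scalar, and a traceless scalar matrix is zero.\<close>
lemma traceless_eigenvectors_full_spark:
  fixes Z :: "complex^'n^'d" and H :: "complex^'d^'d"
  assumes card: "CARD('n) > CARD('d)" and spark: "full_spark Z" and tr: "trace H = 0"
    and eig: "\<And>j. H *v column j Z = \<mu> j *s column j Z"
  shows "H = 0"
proof -
  obtain s :: "'d \<Rightarrow> 'n" where s: "inj s"
    using card card_le_inj[of "UNIV :: 'd set" "UNIV :: 'n set"] by auto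
  have "range s \<noteq> UNIV"
    using card card_image[OF s] by (metis less_irrefl)
  then obtain j where j: "j \<notin> range s" by blast
  define A where "A = select_columns s Z"
  have detA: "det A \<noteq> 0"
    using spark s by (simp add: full_spark_iff_det A_def)
  obtain x where x: "A *v x = column j Z"
    using cramer[OF detA] by blast
  have x0: "x $ k \<noteq> 0" for k
  proof -
    have "inj (s(k := j))" using s j by (auto simp: inj_on_def)
    then have "det (select_columns (s(k := j)) Z) \<noteq> 0"
      using spark unfolding full_spark_iff_det by blast
    moreover have "select_columns (s(k := j)) Z = (\<chi> i l. if l = k then (A *v x) $ i else A $ i $ l)"
      unfolding x by (simp add: select_columns_def A_def column_def vec_eq_iff)
    ultimately show ?thesis by (simp add: cramer_lemma)
  qed
  define D :: "complex^'d^'d" where "D = (\<chi> k l. if k = l then \<mu> (s k) else 0)"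
  have HA: "H ** A = A ** D"
  proof -
    have "(H ** A) $ i $ k = (H *v column (s k) Z) $ i" for i k
      by (simp add: matrix_matrix_mult_def matrix_vector_mult_def A_def select_columns_def column_def)
    then show ?thesis
      by (simp add: eig vec_eq_iff) (simp add: matrix_matrix_mult_def D_def A_def select_columns_def column_def
        if_distrib mult.commute cong: if_cong)
  qed
  have "A *v (D *v x) = A *v (\<mu> j *s x)"
    by (metis HA eig matrix_vector_mul_assoc matrix_vector_mult_scaleR vector_scalar_commute x)
  then have Dx: "D *v x = \<mu> j *s x"
    using cramer[OF detA, of "D *v x" "A *v (\<mu> j *s x)"]
      cramer[OF detA, of "\<mu> j *s x" "A *v (\<mu> j *s x)"] by simp
  have "(D *v x) $ k = \<mu> (s k) * x $ k" for k
    by (simp add: matrix_vector_mult_def D_def if_distrib if_distribR cong: if_cong)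
  then have "\<mu> (s k) = \<mu> j" for k
    using Dx x0[of k] by (metis mult_right_cancel vector_smult_component)
  then have "D = mat (\<mu> j)" by (simp add: D_def mat_def vec_eq_iff)
  moreover have "A ** mat (\<mu> j) = mat (\<mu> j) ** A"
    by (simp add: matrix_matrix_mult_def mat_def vec_eq_iff if_distrib if_distribR mult.commute cong: if_cong)
  ultimately have "(H - mat (\<mu> j)) ** A = 0"
    using HA by (simp add: bounded_bilinear.diff_left[OF bounded_bilinear_matrix_mult])
  moreover obtain B where "A ** B = mat 1"
    using detA invertible_det_nz[of A] by (auto simp: invertible_def)
  ultimately have "H - mat (\<mu> j) = 0"
    by (metis matrix_mul_assoc matrix_mul_rid bounded_bilinear.zero_left[OF bounded_bilinear_matrix_mult])
  then have H: "H = mat (\<mu> j)" by simp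
  with tr have "\<mu> j = 0" by (simp add: trace_mat)
  with H show ?thesis by simp
qed

text \<open>A quantity that detects full spark and grows along the flow. The product ranges over ordered
selections of distinct columns, so each maximal minor occurs with all its orderings.\<close>
definition spark_product :: "complex^'n^'d \<Rightarrow> real"
  where "spark_product Z = (\<Prod>s | inj s. (cmod (det (select_columns s Z)))\<^sup>2)"

lemma spark_product_pos_iff: "spark_product Z > 0 \<longleftrightarrow> full_spark Z"
proof -
  have "spark_product Z > 0 \<longleftrightarrow> spark_product Z \<noteq> 0"
    unfolding spark_product_def by (metis less_le prod_nonneg zero_le_power2)
  also have "\<dots> \<longleftrightarrow> full_spark Z"
    by (simp add: spark_product_def full_spark_iff_det)
  finally show ?thesis .
qed

lemma continuous_on_spark_product: "continuous_on S (spark_product :: complex^'n^'d \<Rightarrow> real)"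
proof -
  have "continuous_on UNIV (det :: complex^'d^'d \<Rightarrow> complex)"
    by (rule has_derivative_continuous_on[OF has_derivative_det])
  then have "continuous_on S (\<lambda>Z :: complex^'n^'d. det (select_columns s Z))" for s
    by (rule continuous_on_compose2[OF _ bounded_linear.continuous_on[OF bounded_linear_select_columns continuous_on_id]]) simp
  then show ?thesis
    unfolding spark_product_def[abs_def] by (intro continuous_intros)
qed

lemma norm_unit_norm_matrices:
  fixes Z :: "complex^'n^'d"
  assumes "Z \<in> unit_norm_matrices"
  shows "norm Z = sqrt (real CARD('n))"
  by (simp add: norm_eq_sqrt_inner inner_eq_sum_columns unit_columnD[OF assms])

lemma closed_unit_norm_matrices: "closed (unit_norm_matrices :: (complex^'n^'d) set)"
  unfolding unit_norm_matrices_def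
  by (intro closed_Collect_all closed_Collect_eq continuous_intros
      bounded_linear.continuous_on[OF bounded_linear_column])

lemma compact_spark_superlevel:
  "compact {Z :: complex^'n^'d. Z \<in> unit_norm_matrices \<and> q \<le> spark_product Z}"
proof -
  have "bounded {Z :: complex^'n^'d. Z \<in> unit_norm_matrices \<and> q \<le> spark_product Z}"
    by (auto simp: bounded_iff norm_unit_norm_matrices)
  moreover have "closed {Z :: complex^'n^'d. Z \<in> unit_norm_matrices \<and> q \<le> spark_product Z}"
    by (intro closed_Collect_conj closed_Collect_le continuous_intros continuous_on_spark_product)
       (use closed_unit_norm_matrices in simp)
  ultimately show ?thesis by (simp add: compact_eq_bounded_closed)
qed

text \<open>A uniform linear lower bound for the gradient in terms of the defect, obtained by compactness. On
the set where \<open>spark_product\<close> is at least \<open>q\<close> and \<open>H\<close> is traceless of norm one, the right-hand side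
vanishes only if every column of \<open>Z\<close> is an eigenvector of \<open>H\<close>, which
\<open>traceless_eigenvectors_full_spark\<close> excludes. It is a gradient inequality of Lojasiewicz type with
exponent 1/2, and this exponent yields exponential convergence.\<close>
lemma gradient_inequality:
  assumes card: "CARD('n) > CARD('d)" and q: "q > 0"
  obtains \<kappa> where "\<kappa> > 0"
    and "\<And>(Z :: complex^'n^'d) (H :: complex^'d^'d).
      Z \<in> unit_norm_matrices \<Longrightarrow> q \<le> spark_product Z \<Longrightarrow> trace H = 0 \<Longrightarrow>
      \<kappa> * norm H \<le> norm (tangent_proj Z (H ** Z))"
proof -
  define K where "K = {Z :: complex^'n^'d. Z \<in> unit_norm_matrices \<and> q \<le> spark_product Z}"
  define T where "T = {H :: complex^'d^'d. norm H = 1 \<and> trace H = 0}"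
  let ?g = "\<lambda>x :: (complex^'n^'d) \<times> (complex^'d^'d). norm (tangent_proj (fst x) (snd x ** fst x))"
  have "closed T"
    unfolding T_def trace_def
    by (intro closed_Collect_conj closed_Collect_eq continuous_intros)
  moreover have "bounded T" by (auto simp: T_def bounded_iff)
  ultimately have comp: "compact (K \<times> T)"
    using compact_spark_superlevel unfolding K_def by (intro compact_Times) (auto simp: compact_eq_bounded_closed)
  have cont: "continuous_on (K \<times> T) ?g"
    unfolding tangent_proj_def column_def matrix_matrix_mult_def by (intro continuous_intros)
  have pos: "?g x > 0" if "x \<in> K \<times> T" for x
  proof (rule ccontr)
    obtain Z H where x: "x = (Z, H)" by (cases x)
    assume "\<not> ?g x > 0"
    then have "tangent_proj Z (H ** Z) = 0" by (simp add: x)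
    then have "column j (H ** Z) = inner (column j Z) (column j (H ** Z)) *\<^sub>R column j Z" for j
    proof -
      have "column j (tangent_proj Z (H ** Z)) = 0"
        using \<open>tangent_proj Z (H ** Z) = 0\<close> by (simp add: column_def vec_eq_iff)
      then show ?thesis
        unfolding column_tangent_proj by (simp only: right_minus_eq)
    qed
    moreover have "column j (H ** Z) = H *v column j Z" for j
      by (simp add: column_def matrix_matrix_mult_def matrix_vector_mult_def)
    moreover have "r *\<^sub>R x = of_real r *s x" for r and x :: "complex^'d"
      by (simp add: vec_eq_iff) (simp add: scaleR_conv_of_real)
    ultimately have "H *v column j Z = of_real (inner (column j Z) (column j (H ** Z))) *s column j Z" for j
      by metis
    moreover have "full_spark Z" "trace H = 0"
      using that q by (auto simp: x K_def T_def simp flip: spark_product_pos_iff)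
    ultimately have "H = 0"
      by (intro traceless_eigenvectors_full_spark[OF card])
    then show False using that by (simp add: x T_def)
  qed
  obtain \<kappa> where \<kappa>: "\<kappa> > 0" "\<And>x. x \<in> K \<times> T \<Longrightarrow> \<kappa> \<le> ?g x"
    \<comment> \<open>The set is empty for \<open>d = 1\<close>, where only the zero matrix is traceless.\<close>
  proof (cases "K \<times> T = {}")
    case True
    then show ?thesis using that[of 1] by auto
  next
    case False
    then obtain x0 where "x0 \<in> K \<times> T" "\<forall>x\<in>K \<times> T. ?g x0 \<le> ?g x"
      using continuous_attains_inf[OF comp _ cont] by blast
    then show ?thesis using that[of "?g x0"] pos by blast
  qed
  show ?thesis
  proof (rule that[OF \<kappa>(1)])
    fix Z :: "complex^'n^'d" and H :: "complex^'d^'d"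
    assume Z: "Z \<in> unit_norm_matrices" "q \<le> spark_product Z" and tr: "trace H = 0"
    show "\<kappa> * norm H \<le> norm (tangent_proj Z (H ** Z))"
    proof (cases "H = 0")
      case False
      define r where "r = inverse (norm H)"
      have r: "r > 0" using False by (simp add: r_def)
      have "trace (r *\<^sub>R H) = r *\<^sub>R trace H" by (simp add: trace_def scaleR_sum_right)
      then have "(Z, r *\<^sub>R H) \<in> K \<times> T"
        using Z tr False by (simp add: K_def T_def r_def)
      then have "\<kappa> \<le> norm (tangent_proj Z ((r *\<^sub>R H) ** Z))" using \<kappa>(2) by fastforce
      also have "(r *\<^sub>R H) ** Z = r *\<^sub>R (H ** Z)"
        by (simp add: matrix_matrix_mult_def vec_eq_iff scaleR_sum_right)
      also have "tangent_proj Z (r *\<^sub>R (H ** Z)) = r *\<^sub>R tangent_proj Z (H ** Z)"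
        unfolding tangent_proj_def column_scaleR by (simp add: vec_eq_iff scaleR_diff_right)
      finally show ?thesis using r False by (simp add: r_def field_simps)
    qed simp
  qed
qed


section \<open>Convergence of the flow\<close>

lemma exponential_decay_tendsto_0:
  fixes a C :: real
  assumes "a > 0"
  shows "((\<lambda>t. C * exp (- a * t)) \<longlongrightarrow> 0) at_top"
proof -
  have "LIM t at_top. - a * t :> at_bot"
    using assms by (intro filterlim_tendsto_neg_mult_at_bot[OF tendsto_const] filterlim_ident) auto
  then show ?thesis
    by (intro tendsto_mult_right_zero filterlim_compose[OF exp_at_bot])
qed

text \<open>A curve whose speed decays exponentially has finite length, so it converges; \<open>b t\<close> bounds the length
that remains after time \<open>t\<close>.\<close>
lemma exponential_decay_converges:
  fixes f :: "real \<Rightarrow> 'a::banach"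
  assumes der: "\<And>t. t \<ge> 0 \<Longrightarrow> (f has_vector_derivative f' t) (at t within {0..})"
    and bound: "\<And>t. t \<ge> 0 \<Longrightarrow> norm (f' t) \<le> C * exp (- a * t)"
    and a: "a > 0"
  obtains L where "(f \<longlongrightarrow> L) at_top"
proof -
  define b where "b t = C / a * exp (- a * t)" for t
  have C: "C \<ge> 0" using order_trans[OF norm_ge_zero bound[of 0]] by simp
  have cont: "continuous_on {0..} f"
    by (rule continuous_on_vector_derivative[OF der]) simp
  have diff: "norm (f t - f s) \<le> b s" if st: "0 \<le> s" "s \<le> t" for s t
  proof (cases "s = t")
    case True
    then show ?thesis using C a by (simp add: b_def)
  next
    case False
    have "norm (f t - f s) \<le> - b t - (- b s)"
    proof (rule differentiable_bound_general[where f'=f' and \<phi>'="\<lambda>t. C * exp (- a * t)"])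
      show "continuous_on {s..t} f" using st by (intro continuous_on_subset[OF cont]) auto
      show "continuous_on {s..t} (\<lambda>t. - b t)" unfolding b_def by (intro continuous_intros)
      fix x assume x: "s < x" "x < t"
      show "(f has_vector_derivative f' x) (at x)"
        using der[of x] x st at_within_interior[of x "{0..}"] by simp
      show "((\<lambda>t. - b t) has_vector_derivative C * exp (- a * x)) (at x)"
        unfolding b_def using a
        by (auto intro!: derivative_eq_intros simp flip: has_real_derivative_iff_has_vector_derivative)
      show "norm (f' x) \<le> C * exp (- a * x)" using x st by (intro bound) auto
    qed (use st False in auto)
    moreover have "b t \<ge> 0" using C a by (simp add: b_def)
    ultimately show ?thesis by simp
  qed
  have b0: "(b \<longlongrightarrow> 0) at_top"
    unfolding b_def by (rule exponential_decay_tendsto_0[OF a])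
  define X where "X n = f (real n)" for n
  have "Cauchy X"
  proof (rule CauchyI)
    fix e :: real assume "e > 0"
    then have "eventually (\<lambda>n. b (real n) < e / 2) sequentially"
      using order_tendstoD(2)[OF filterlim_compose[OF b0 filterlim_real_sequentially], of "e / 2"] by simp
    then obtain N where N: "b (real N) < e / 2" by (meson eventually_sequentially order_refl)
    show "\<exists>M. \<forall>m\<ge>M. \<forall>n\<ge>M. norm (X m - X n) < e"
    proof (intro exI allI impI)
      fix m n assume "N \<le> m" "N \<le> n"
      then have "norm (X m - X N) \<le> b N" "norm (X n - X N) \<le> b N"
        unfolding X_def by (auto intro!: diff)
      then show "norm (X m - X n) < e"
        using N norm_triangle_ineq4[of "X m - X N" "X n - X N"] by simp
    qed
  qed
  then obtain L where L: "X \<longlonglongrightarrow> L" by (auto simp: Cauchy_convergent_iff convergent_def)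
  have "norm (f s - L) \<le> b s" if "s \<ge> 0" for s
  proof (rule tendsto_upperbound)
    show "((\<lambda>n. norm (f s - X n)) \<longlongrightarrow> norm (f s - L)) sequentially"
      by (intro tendsto_intros L)
    show "eventually (\<lambda>n. norm (f s - X n) \<le> b s) sequentially"
      using eventually_ge_at_top[of "nat \<lceil>s\<rceil>"]
    proof eventually_elim
      case (elim n)
      then show ?case
        using diff[of s "real n"] that unfolding X_def by (subst norm_minus_commute) (simp add: nat_le_iff ceiling_le_iff)
    qed
  qed simp
  then have "((\<lambda>s. f s - L) \<longlongrightarrow> 0) at_top"
    by (intro Lim_null_comparison[OF _ b0] eventually_at_top_linorderI[of 0])
  then show ?thesis using that by (simp add: LIM_zero_iff)
qed

text \<open>A minor belonging to a selection \<open>s\<close> grows at the rate \<open>r s = - 4 (n - \<Sum>\<^sub>k a (s k))\<close>, where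
\<open>a j = \<langle>z\<^sub>j, Z Z\<^sup>* z\<^sub>j\<rangle>\<close>. Single rates may have either sign. Their sum over all selections is a positive
multiple of \<open>FP Z - n\<^sup>2 / d\<close>, because \<open>\<Sum>\<^sub>j a j = FP Z\<close> and all columns are selected equally often.\<close>
lemma spark_product_has_real_derivative:
  fixes z :: "real \<Rightarrow> complex^'n^'d"
  assumes Z: "z t \<in> unit_norm_matrices"
    and der: "(z has_vector_derivative - (4 *\<^sub>R tangent_proj (z t) (z t ** conj_transpose (z t) ** z t)))
      (at t within T)"
  shows "((\<lambda>t. spark_product (z t)) has_real_derivative
    8 * real (card {s :: 'd \<Rightarrow> 'n. inj s}) * real CARD('d) / real CARD('n) *
      (norm (frame_defect (z t)))\<^sup>2 * spark_product (z t)) (at t within T)"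
proof -
  let ?I = "{s :: 'd \<Rightarrow> 'n. inj s}"
  let ?S = "z t ** conj_transpose (z t)"
  define n d m where "n = real CARD('n)" and "d = real CARD('d)" and "m = real (card ?I)"
  have n: "n > 0" and d: "d > 0" by (simp_all add: n_def d_def)
  define a where "a j = inner (column j (z t)) (column j (?S ** z t))" for j
  define y where "y s u = det (select_columns s (z u))" for s :: "'d \<Rightarrow> 'n" and u
  define r where "r s = - 4 * (n - (\<Sum>k\<in>UNIV. a (s k)))" for s :: "'d \<Rightarrow> 'n"
  have y: "(y s has_vector_derivative r s *\<^sub>R y s t) (at t within T)" for s
  proof -
    have "((\<lambda>u. select_columns s (z u)) has_vector_derivative
        select_columns s (- (4 *\<^sub>R tangent_proj (z t) (?S ** z t)))) (at t within T)"
      by (rule bounded_linear.has_vector_derivative[OF bounded_linear_select_columns der])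
    then have "((\<lambda>u. det (select_columns s (z u))) has_vector_derivative
        det_deriv (select_columns s (z t)) (select_columns s (- (4 *\<^sub>R tangent_proj (z t) (?S ** z t)))))
        (at t within T)"
      using vector_derivative_diff_chain_within[OF _ has_derivative_det] by (simp add: o_def)
    moreover have "det_deriv (select_columns s (z t)) (select_columns s (- (4 *\<^sub>R tangent_proj (z t) (?S ** z t))))
       = r s *\<^sub>R y s t"
      unfolding linear_neg[OF bounded_linear.linear[OF bounded_linear_select_columns]]
        linear_cmul[OF bounded_linear.linear[OF bounded_linear_select_columns]]
        linear_neg[OF linear_det_deriv] linear_cmul[OF linear_det_deriv]
        det_deriv_select_columns_flow trace_frame_operator[OF Z]
      by (simp add: r_def y_def a_def n_def scaleR_conv_of_real algebra_simps)
    ultimately show ?thesis by (simp add: y_def[abs_def])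
  qed
  have y2: "((\<lambda>u. (cmod (y s u))\<^sup>2) has_derivative (\<lambda>h. h * (2 * r s * (cmod (y s t))\<^sup>2))) (at t within T)" for s
  proof -
    have "((\<lambda>u. inner (y s u) (y s u)) has_vector_derivative
        inner (y s t) (r s *\<^sub>R y s t) + inner (r s *\<^sub>R y s t) (y s t)) (at t within T)"
      by (rule bounded_bilinear.has_vector_derivative[OF bounded_bilinear_inner y y])
    then show ?thesis
      by (simp add: has_vector_derivative_def power2_norm_eq_inner algebra_simps)
  qed
  have "((\<lambda>u. \<Prod>s\<in>?I. (cmod (y s u))\<^sup>2) has_derivative
      (\<lambda>h. \<Sum>s\<in>?I. h * (2 * r s * (cmod (y s t))\<^sup>2) * (\<Prod>s'\<in>?I - {s}. (cmod (y s' t))\<^sup>2))) (at t within T)"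
    by (rule has_derivative_prod) (rule y2)
  also have "(\<lambda>h. \<Sum>s\<in>?I. h * (2 * r s * (cmod (y s t))\<^sup>2) * (\<Prod>s'\<in>?I - {s}. (cmod (y s' t))\<^sup>2))
      = (\<lambda>h. \<Sum>s\<in>?I. r s * (2 * spark_product (z t) * h))"
  proof (intro ext sum.cong refl)
    fix h s assume "s \<in> ?I"
    then show "h * (2 * r s * (cmod (y s t))\<^sup>2) * (\<Prod>s'\<in>?I - {s}. (cmod (y s' t))\<^sup>2)
      = r s * (2 * spark_product (z t) * h)"
      using prod.remove[of ?I s "\<lambda>s. (cmod (y s t))\<^sup>2"] by (simp add: spark_product_def y_def)
  qed
  finally have 1: "((\<lambda>u. spark_product (z u)) has_derivative
      (\<lambda>h. \<Sum>s\<in>?I. r s * (2 * spark_product (z t) * h))) (at t within T)"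
    by (simp add: spark_product_def[abs_def] y_def)
  have "(\<Sum>j\<in>UNIV. a j) = frame_potential (z t)"
    unfolding a_def frame_potential_eq_inner by (simp add: inner_eq_sum_columns)
  also have "\<dots> = (norm (frame_defect (z t)))\<^sup>2 + n\<^sup>2 / d"
    using norm_frame_defect[OF Z] by (simp add: n_def d_def)
  finally have "n * (\<Sum>s\<in>?I. \<Sum>k\<in>UNIV. a (s k)) = m * d * ((norm (frame_defect (z t)))\<^sup>2 + n\<^sup>2 / d)"
    using sum_over_injections[of a, where 'd='d] by (simp add: n_def d_def m_def)
  also have "\<dots> = m * d * (norm (frame_defect (z t)))\<^sup>2 + n * (m * n)"
    using d by (simp add: distrib_left power2_eq_square)
  finally have "n * ((\<Sum>s\<in>?I. \<Sum>k\<in>UNIV. a (s k)) - m * n) = m * d * (norm (frame_defect (z t)))\<^sup>2"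
    by (simp add: right_diff_distrib)
  then have "(\<Sum>s\<in>?I. \<Sum>k\<in>UNIV. a (s k)) - m * n = m * d * (norm (frame_defect (z t)))\<^sup>2 / n"
    using n by (simp only: eq_divide_eq mult.commute) simp
  moreover have "(\<Sum>s\<in>?I. r s) = 4 * ((\<Sum>s\<in>?I. \<Sum>k\<in>UNIV. a (s k)) - m * n)"
    by (simp add: r_def sum_distrib_left[symmetric] sum_subtractf sum_negf m_def)
  ultimately have "(\<Sum>s\<in>?I. r s) = 4 * m * d / n * (norm (frame_defect (z t)))\<^sup>2"
    by simp
  then have "(\<lambda>h. \<Sum>s\<in>?I. r s * (2 * spark_product (z t) * h)) =
      (*) (8 * m * d / n * (norm (frame_defect (z t)))\<^sup>2 * spark_product (z t))"
    by (simp add: fun_eq_iff flip: sum_distrib_right)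
  with 1 show ?thesis
    by (simp only: has_field_derivative_def n_def d_def m_def)
qed

lemma frame_potential_along_flow:
  fixes z :: "real \<Rightarrow> complex^'n^'d"
  assumes Z: "z t \<in> unit_norm_matrices"
    and der: "(z has_vector_derivative - (4 *\<^sub>R tangent_proj (z t) (z t ** conj_transpose (z t) ** z t)))
      (at t within T)"
  shows "((\<lambda>t. frame_potential (z t)) has_real_derivative
    - 16 * (norm (tangent_proj (z t) (frame_defect (z t) ** z t)))\<^sup>2) (at t within T)"
  using frame_potential_has_vector_derivative[OF der]
    inner_tangent_proj[OF tangent_proj_tangent[OF Z]]
  by (simp add: has_real_derivative_iff_has_vector_derivative tangent_proj_frame_defect[OF Z] power2_norm_eq_inner)

theorem theorem3:
  fixes F :: "complex^'n^'d \<Rightarrow> real \<Rightarrow> complex^'n^'d"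
    and Z0 :: "complex^'n^'d"
  assumes "CARD('n) > CARD('d)"
    and "is_gradient_flow unit_norm_matrices frame_potential F"
    and "Z0 \<in> unit_norm_matrices"
    and "full_spark Z0"
  shows "\<exists>L. (F Z0 \<longlongrightarrow> L) at_top \<and> unit_norm_tight_frame L"
proof -
  define z where "z = F Z0"
  have z0: "z 0 = Z0" and unit: "\<And>t. t \<ge> 0 \<Longrightarrow> z t \<in> unit_norm_matrices"
    and "\<And>t. t \<ge> 0 \<Longrightarrow> (z has_vector_derivative
        - riemannian_grad unit_norm_matrices frame_potential (z t)) (at t within {0..})"
    using assms(2,3) unfolding is_gradient_flow_def z_def by auto
  then have der: "(z has_vector_derivative
      - (4 *\<^sub>R tangent_proj (z t) (z t ** conj_transpose (z t) ** z t))) (at t within {0..})" if "t \<ge> 0" for t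
    using riemannian_grad_frame_potential[OF unit[OF that]] that by metis
  define H where "H t = frame_defect (z t)" for t
  define P where "P t = tangent_proj (z t) (H t ** z t)" for t
  have der': "(z has_vector_derivative - (4 *\<^sub>R P t)) (at t within {0..})" if "t \<ge> 0" for t
    using der[OF that] tangent_proj_frame_defect[OF unit[OF that]] by (simp add: P_def H_def)
  have at: "at t within {0..} = at t" if "t > 0" for t :: real
    using that at_within_interior[of t "{0..}"] by simp
  have cont: "continuous_on {0..} z"
    by (rule continuous_on_vector_derivative[OF der]) simp

  \<comment> \<open>The product of the minors is nondecreasing, which confines the trajectory to full spark matrices,
    away from the other critical points.\<close>
  define q where "q = spark_product Z0"
  have q: "q > 0" using assms(4) by (simp add: q_def spark_product_pos_iff)
  have spark: "q \<le> spark_product (z t)" if t: "t \<ge> 0" for t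
  proof -
    have "spark_product (z 0) \<le> spark_product (z t)"
    proof (rule DERIV_nonneg_imp_increasing_open[OF t])
      show "continuous_on {0..t} (\<lambda>t. spark_product (z t))"
        by (rule continuous_on_compose2[OF continuous_on_spark_product[of UNIV] continuous_on_subset[OF cont]]) auto
      fix u assume u: "0 < u" "u < t"
      have "spark_product (z u) \<ge> 0" unfolding spark_product_def by (simp add: prod_nonneg)
      then show "\<exists>y. ((\<lambda>t. spark_product (z t)) has_real_derivative y) (at u) \<and> 0 \<le> y"
        using spark_product_has_real_derivative[OF unit der, of u] u at[of u] by fastforce
    qed
    then show ?thesis by (simp add: q_def z0)
  qed

  obtain \<kappa> where \<kappa>: "\<kappa> > 0" and grad_ineq:
    "\<And>(Z :: complex^'n^'d) (H :: complex^'d^'d).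
      Z \<in> unit_norm_matrices \<Longrightarrow> q \<le> spark_product Z \<Longrightarrow> trace H = 0 \<Longrightarrow>
      \<kappa> * norm H \<le> norm (tangent_proj Z (H ** Z))"
    using gradient_inequality[OF assms(1) q] by blast
  have PH: "\<kappa> * norm (H t) \<le> norm (P t)" if "t \<ge> 0" for t
    unfolding P_def H_def using that by (intro grad_ineq unit spark trace_frame_defect)

  \<comment> \<open>The excess \<open>\<parallel>H\<parallel>\<^sup>2\<close> of the frame potential has derivative \<open>- 16 \<parallel>P\<parallel>\<^sup>2 \<le> - b \<parallel>H\<parallel>\<^sup>2\<close>.\<close>
  define b where "b = 16 * \<kappa>\<^sup>2"
  have H_decay: "(norm (H t))\<^sup>2 \<le> (norm (H 0))\<^sup>2 * exp (- b * t)" if t: "t \<ge> 0" for t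
  proof -
    define h where "h u = (frame_potential (z u) - (real CARD('n))\<^sup>2 / real CARD('d))" for u
    have h: "h u = (norm (H u))\<^sup>2" if "u \<ge> 0" for u
      using norm_frame_defect[OF unit[OF that]] by (simp add: h_def H_def)
    have dh: "(h has_real_derivative - 16 * (norm (P u))\<^sup>2) (at u within {0..})" if "u \<ge> 0" for u
      using frame_potential_along_flow[of z, OF unit der, OF that that]
      unfolding h_def P_def H_def by (auto intro!: derivative_eq_intros)
    have "h t * exp (b * t) \<le> h 0 * exp (b * 0)"
    proof (rule DERIV_nonpos_imp_decreasing_open[OF t])
      have "continuous_on {0..} h"
        by (rule DERIV_continuous_on[OF dh]) simp
      then have "continuous_on {0..t} h"
        by (rule continuous_on_subset) auto
      then show "continuous_on {0..t} (\<lambda>u. h u * exp (b * u))"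
        by (intro continuous_intros)
      fix u assume u: "0 < u" "u < t"
      have "((\<lambda>u. h u * exp (b * u)) has_real_derivative
          (- 16 * (norm (P u))\<^sup>2 + b * h u) * exp (b * u)) (at u)"
        using dh[of u] u at[of u] by (auto intro!: derivative_eq_intros simp: algebra_simps)
      moreover have "(\<kappa> * norm (H u))\<^sup>2 \<le> (norm (P u))\<^sup>2"
        using PH[of u] \<kappa> u by (intro power_mono) auto
      then have "(- 16 * (norm (P u))\<^sup>2 + b * h u) * exp (b * u) \<le> 0"
        using u by (simp add: h b_def power_mult_distrib mult_le_0_iff)
      ultimately show "\<exists>y. ((\<lambda>u. h u * exp (b * u)) has_real_derivative y) (at u) \<and> y \<le> 0"
        by blast
    qed
    then show ?thesis using t by (simp add: h exp_minus field_simps)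
  qed
  have H_decay': "norm (H t) \<le> norm (H 0) * exp (- (b / 2) * t)" if "t \<ge> 0" for t
  proof (rule power2_le_imp_le)
    have "(exp (- (b / 2) * t))\<^sup>2 = exp (- b * t)"
      by (simp add: power2_eq_square flip: exp_add)
    then show "(norm (H t))\<^sup>2 \<le> (norm (H 0) * exp (- (b / 2) * t))\<^sup>2"
      using H_decay[OF that] by (simp add: power_mult_distrib)
  qed simp

  \<comment> \<open>The speed is at most a constant times the norm of the defect, so it decays exponentially as well.\<close>
  obtain B where B: "\<And>(X :: complex^'d^'d) (Y :: complex^'n^'d). norm (X ** Y) \<le> norm X * norm Y * B"
    using bounded_bilinear.bounded[OF bounded_bilinear_matrix_mult] by blast
  define C where "C = 4 * sqrt (real CARD('n)) * \<bar>B\<bar> * norm (H 0)"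
  have speed: "norm (- (4 *\<^sub>R P t)) \<le> C * exp (- (b / 2) * t)" if t: "t \<ge> 0" for t
  proof -
    have "norm (P t) \<le> norm (H t ** z t)"
      unfolding P_def by (rule norm_tangent_proj_le[OF unit[OF t]])
    also have "\<dots> \<le> norm (H t) * sqrt (real CARD('n)) * B"
      using B[of "H t" "z t"] by (simp add: norm_unit_norm_matrices[OF unit[OF t]])
    also have "\<dots> \<le> norm (H t) * sqrt (real CARD('n)) * \<bar>B\<bar>"
      by (intro mult_left_mono) auto
    also have "\<dots> \<le> norm (H 0) * exp (- (b / 2) * t) * sqrt (real CARD('n)) * \<bar>B\<bar>"
      by (intro mult_right_mono H_decay' t) auto
    finally show ?thesis by (simp add: C_def mult_ac)
  qed
  have b: "b > 0" using \<kappa> by (simp add: b_def)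
  obtain L where L: "(z \<longlongrightarrow> L) at_top"
    using exponential_decay_converges[OF der' speed] b by auto

  have "L \<in> unit_norm_matrices"
    by (rule Lim_in_closed_set[OF closed_unit_norm_matrices _ _ L])
      (auto intro: unit eventually_at_top_linorderI)
  moreover have "frame_defect L = 0"
  proof -
    have "((\<lambda>t. frame_defect (z t)) \<longlongrightarrow> frame_defect L) at_top"
      unfolding frame_defect_def
      by (intro tendsto_intros bounded_bilinear.tendsto[OF bounded_bilinear_matrix_mult]
          bounded_linear.tendsto[OF bounded_linear_conj_transpose] L)
    moreover have "((\<lambda>t. norm (H 0) * exp (- (b / 2) * t)) \<longlongrightarrow> 0) at_top"
      using b by (intro exponential_decay_tendsto_0) simp
    then have "((\<lambda>t. frame_defect (z t)) \<longlongrightarrow> 0) at_top"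
      using H_decay' unfolding H_def
      by (elim Lim_null_comparison[rotated]) (auto intro: eventually_at_top_linorderI)
    ultimately show ?thesis using tendsto_unique trivial_limit_at_top_linorder by blast
  qed
  ultimately have "unit_norm_tight_frame L"
    by (auto simp: unit_norm_tight_frame_def unit_norm_matrices_def frame_defect_def)
  with L show ?thesis unfolding z_def by blast
qed

end
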